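(* If a finite group $G$ contains a normal abelian subgroup of index at most $3$, then $\mathcal{N}_G=0$.
   Context: For a finite group $G$, two elements $g,h\in G$ are $\mathbb{R}$-$\mathrm{Aut}(G)$-conjugate if $g$ is in the $\mathrm{Aut}(G)$-orbit of $h$ or of $h^{-1}$; they are $\mathbb{Q}$-$\mathrm{Aut}(G)$-conjugate if the cyclic subgroups $\langle g\rangle$ and $\langle h\rangle$ are in the same $\mathrm{Aut}(G)$-orbit. Define $$\mathcal{N}_G = \#\{\mathbb{R}\text{-}\mathrm{Aut}(G)\text{-conjugacy classes in } G\} - \#\{\mathbb{Q}\text{-}\mathrm{Aut}(G)\text{-conjugacy classes in } G\}.$$ *)

theory Defs
  imports "HOL-Algebra.Algebra"
begin

definition real_aut_conj :: "('a, 'b) monoid_scheme \<Rightarrow> ('a \<times> 'a) set" where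
  "real_aut_conj G = {(g, h). g \<in> carrier G \<and> h \<in> carrier G \<and>
     (g \<in> orbit (AutoGroup G) (\<lambda>\<phi>. \<phi>) h \<or> g \<in> orbit (AutoGroup G) (\<lambda>\<phi>. \<phi>) (inv\<^bsub>G\<^esub> h))}"

definition rat_aut_conj :: "('a, 'b) monoid_scheme \<Rightarrow> ('a \<times> 'a) set" where
  "rat_aut_conj G = {(g, h). g \<in> carrier G \<and> h \<in> carrier G \<and>
     generate G {g} \<in> orbit (AutoGroup G) (\<lambda>\<phi> H. \<phi> ` H) (generate G {h})}"

lemma mem_orbit_AutoGroup: "y \<in> orbit (AutoGroup G) a x \<longleftrightarrow> (\<exists>\<phi>\<in>auto G. y = a \<phi> x)"
  by (auto simp: orbit_def AutoGroup_def)

context group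
begin

lemma compose_auto: "\<phi> \<in> auto G \<Longrightarrow> \<psi> \<in> auto G \<Longrightarrow> compose (carrier G) \<phi> \<psi> \<in> auto G"
  by (auto simp: auto_def compose_Bij intro: group.hom_compose[OF group_axioms])

lemma restrict_inv_into_auto:
  "\<phi> \<in> auto G \<Longrightarrow> restrict (inv_into (carrier G) \<phi>) (carrier G) \<in> auto G"
  by (simp add: auto_def restrict_inv_into_Bij restrict_inv_into_hom)

lemma auto_bij_betw: "\<phi> \<in> auto G \<Longrightarrow> bij_betw \<phi> (carrier G) (carrier G)"
  by (simp add: auto_def Bij_def)

lemma auto_closed: "\<phi> \<in> auto G \<Longrightarrow> x \<in> carrier G \<Longrightarrow> \<phi> x \<in> carrier G"
  using auto_bij_betw bij_betwE by blast

lemma auto_inv: "\<phi> \<in> auto G \<Longrightarrow> x \<in> carrier G \<Longrightarrow> \<phi> (inv x) = inv (\<phi> x)"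
  by (auto simp: auto_def intro!: group_hom.hom_inv group_hom.intro group_hom_axioms.intro group_axioms)

lemma equiv_real_aut_conj: "equiv (carrier G) (real_aut_conj G)"
proof (rule equivI)
  show "real_aut_conj G \<subseteq> carrier G \<times> carrier G"
    by (auto simp: real_aut_conj_def)
  show "refl_on (carrier G) (real_aut_conj G)"
    by (auto simp: refl_on_def real_aut_conj_def mem_orbit_AutoGroup intro!: bexI[OF _ id_in_auto])
  show "sym (real_aut_conj G)"
  proof (rule symI)
    fix g h assume "(g, h) \<in> real_aut_conj G"
    then obtain \<phi> where gh: "g \<in> carrier G" "h \<in> carrier G" "\<phi> \<in> auto G"
      and or: "g = \<phi> h \<or> g = \<phi> (inv h)"
      by (auto simp: real_aut_conj_def mem_orbit_AutoGroup)
    let ?\<psi> = "restrict (inv_into (carrier G) \<phi>) (carrier G)"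
    have inj: "inj_on \<phi> (carrier G)" using gh(3) auto_bij_betw bij_betw_def by blast
    have inv_\<psi>: "?\<psi> (\<phi> x) = x" if "x \<in> carrier G" for x
      using that gh(3) inj by (simp add: auto_closed)
    have "h = ?\<psi> g \<or> h = ?\<psi> (inv g)"
      using or
    proof
      assume "g = \<phi> h"
      then show ?thesis using inv_\<psi>[OF gh(2)] by simp
    next
      assume "g = \<phi> (inv h)"
      then have "inv g = \<phi> h" using gh by (simp add: auto_inv auto_closed)
      then show ?thesis using inv_\<psi>[OF gh(2)] by simp
    qed
    then show "(h, g) \<in> real_aut_conj G"
      using gh restrict_inv_into_auto[OF gh(3)] unfolding real_aut_conj_def mem_orbit_AutoGroup by blast
  qed
  show "trans (real_aut_conj G)"
  proof (rule transI)
    fix g h k assume "(g, h) \<in> real_aut_conj G" "(h, k) \<in> real_aut_conj G"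
    then obtain \<phi> \<psi> where ghk: "g \<in> carrier G" "h \<in> carrier G" "k \<in> carrier G"
      "\<phi> \<in> auto G" "\<psi> \<in> auto G"
      and or: "g = \<phi> h \<or> g = \<phi> (inv h)" "h = \<psi> k \<or> h = \<psi> (inv k)"
      by (auto simp: real_aut_conj_def mem_orbit_AutoGroup)
    have "g = compose (carrier G) \<phi> \<psi> k \<or> g = compose (carrier G) \<phi> \<psi> (inv k)"
      using or ghk by (auto simp: compose_eq auto_inv auto_closed)
    then show "(g, k) \<in> real_aut_conj G"
      using ghk compose_auto[OF ghk(4,5)] unfolding real_aut_conj_def mem_orbit_AutoGroup by blast
  qed
qed

lemma equiv_rat_aut_conj: "equiv (carrier G) (rat_aut_conj G)"
proof (rule equivI)
  have sub: "generate G {g} \<subseteq> carrier G" if "g \<in> carrier G" for g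
    using that generate_incl by simp
  show "rat_aut_conj G \<subseteq> carrier G \<times> carrier G"
    by (auto simp: rat_aut_conj_def)
  show "refl_on (carrier G) (rat_aut_conj G)"
  proof (rule refl_onI)
    fix g assume g: "g \<in> carrier G"
    have "generate G {g} = (\<lambda>x\<in>carrier G. x) ` generate G {g}"
      using sub[OF g] by (simp add: subset_eq)
    then show "(g, g) \<in> rat_aut_conj G"
      using g id_in_auto unfolding rat_aut_conj_def mem_orbit_AutoGroup by blast
  qed
  show "sym (rat_aut_conj G)"
  proof (rule symI)
    fix g h assume "(g, h) \<in> rat_aut_conj G"
    then obtain \<phi> where gh: "g \<in> carrier G" "h \<in> carrier G" "\<phi> \<in> auto G"
      and eq: "generate G {g} = \<phi> ` generate G {h}"
      by (auto simp: rat_aut_conj_def mem_orbit_AutoGroup)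
    let ?\<psi> = "restrict (inv_into (carrier G) \<phi>) (carrier G)"
    have inj: "inj_on \<phi> (carrier G)" using gh(3) auto_bij_betw bij_betw_def by blast
    have "?\<psi> (\<phi> x) = x" if "x \<in> generate G {h}" for x
      using that sub[OF gh(2)] gh(3) inj by (auto simp: auto_closed)
    then have "?\<psi> ` generate G {g} = generate G {h}"
      unfolding eq image_image by (simp cong: image_cong_simp)
    then have "generate G {h} = ?\<psi> ` generate G {g}" ..
    then show "(h, g) \<in> rat_aut_conj G"
      using gh restrict_inv_into_auto[OF gh(3)] unfolding rat_aut_conj_def mem_orbit_AutoGroup by blast
  qed
  show "trans (rat_aut_conj G)"
  proof (rule transI)
    fix g h k assume "(g, h) \<in> rat_aut_conj G" "(h, k) \<in> rat_aut_conj G"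
    then obtain \<phi> \<psi> where ghk: "g \<in> carrier G" "h \<in> carrier G" "k \<in> carrier G"
      "\<phi> \<in> auto G" "\<psi> \<in> auto G"
      and eq: "generate G {g} = \<phi> ` generate G {h}" "generate G {h} = \<psi> ` generate G {k}"
      by (auto simp: rat_aut_conj_def mem_orbit_AutoGroup)
    have "generate G {g} = compose (carrier G) \<phi> \<psi> ` generate G {k}"
      unfolding eq image_image using sub[OF ghk(3)] by (intro image_cong) (auto simp: compose_eq)
    then show "(g, k) \<in> rat_aut_conj G"
      using ghk compose_auto[OF ghk(4,5)] unfolding rat_aut_conj_def mem_orbit_AutoGroup by blast
  qed
qed

end

definition aut_class_diff :: "('a, 'b) monoid_scheme \<Rightarrow> int" where
  "aut_class_diff G =
     int (card (carrier G // real_aut_conj G)) - int (card (carrier G // rat_aut_conj G))"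

end

theory Submission
  imports Defs
begin

text \<open>
  Let \<open>n \<le> 3\<close> be the index of \<open>A\<close>, and let \<open>u = g\<^sup>k\<close> be another generator of \<open>\<langle>g\<rangle>\<close>. Choose \<open>t\<close>
  generating \<open>G\<close> modulo \<open>A\<close>, with \<open>t = g\<close> if \<open>g \<notin> A\<close>, and \<open>m \<equiv> k\<close> modulo the order of \<open>g\<close> and
  coprime to \<open>|G|\<close>. As \<open>m\<close> is a unit modulo \<open>n \<le> 3\<close>, after replacing \<open>m\<close> by \<open>-m\<close> if necessary,
  \<open>m \<equiv> 1\<close> modulo \<open>n\<close>. Then \<open>t\<^sup>m\<close> and \<open>t\<close> induce the same conjugation on \<open>A\<close>, which makes
  \<open>a t\<^sup>i \<mapsto> a\<^sup>m t\<^sup>m\<^sup>i\<close> a well-defined automorphism of \<open>G\<close>. It sends \<open>g\<close> to \<open>u\<close> or its inverse.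
\<close>

section \<open>Units of residue rings\<close>

text \<open>Add to \<open>k\<close> the product of \<open>d\<close> with all primes of
  \<open>N\<close> not dividing \<open>k\<close>: each prime of \<open>N\<close> then divides
  exactly one of the two summands.\<close>

lemma coprime_lift:
  fixes k d N :: int
  assumes "coprime k d" and "N \<noteq> 0"
  shows "\<exists>m. d dvd m - k \<and> coprime m N"
proof -
  define P where "P = {p \<in> prime_factors N. \<not> p dvd k}"
  define m where "m = k + d * \<Prod>P"
  have finP: "finite P" by (simp add: P_def)
  have no_prime: "\<not> p dvd m" if p: "Factorial_Ring.prime p" "p dvd N" for p
  proof (cases "p dvd k")
    case True
    then have "\<not> p dvd d"
      using assms(1) p(1) coprime_common_divisor not_prime_unit by blast
    moreover have "\<not> p dvd \<Prod>P"
    proof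
      assume "p dvd \<Prod>P"
      then obtain q where q: "q \<in> P" "p dvd q"
        using prime_dvd_prod_iff[OF finP p(1), of "\<lambda>x. x"] by auto
      then have "p = q" using p(1) by (auto simp: P_def intro: primes_dvd_imp_eq)
      with q True show False by (simp add: P_def)
    qed
    ultimately show ?thesis
      using True p(1) by (simp add: m_def dvd_add_right_iff prime_dvd_mult_iff)
  next
    case False
    then have "p \<in> P" using p assms(2) by (simp add: P_def in_prime_factors_iff)
    then have "p dvd \<Prod>P" using finP by (metis dvd_prodI)
    then show ?thesis using False by (simp add: m_def dvd_add_left_iff)
  qed
  have "coprime m N"
  proof (rule coprimeI)
    fix c assume c: "c dvd m" "c dvd N"
    show "is_unit c"
    proof (rule ccontr)
      assume "\<not> is_unit c"
      moreover have "c \<noteq> 0" using c(2) assms(2) by auto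
      ultimately obtain p where "p dvd c" "Factorial_Ring.prime p"
        using prime_divisor_exists by blast
      then show False using no_prime c dvd_trans by blast
    qed
  qed
  moreover have "d dvd m - k" by (simp add: m_def)
  ultimately show ?thesis by blast
qed

text \<open>Allows an exponent to be normalized to 1 modulo the index up to a sign, which the
  inverse in \<open>real_aut_conj\<close> absorbs.\<close>

lemma unit_mod_le_3:
  fixes m n :: int
  assumes "coprime m n" and "0 < n" and "n \<le> 3"
  shows "n dvd m - 1 \<or> n dvd - m - 1"
proof -
  consider "n = 1" | "n = 2" | "n = 3" using assms(2,3) by linarith
  then show ?thesis
  proof cases
    case 1
    then show ?thesis by simp
  next
    case 2
    then have "\<not> 2 dvd m" using assms(1) coprime_common_divisor[of m n 2] by auto
    then show ?thesis using 2 by presburger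
  next
    case 3
    then have "\<not> 3 dvd m" using assms(1) coprime_common_divisor[of m n 3] by auto
    then show ?thesis using 3 by presburger
  qed
qed

section \<open>Power automorphisms\<close>

context group
begin

lemma int_pow_conjugate:
  assumes "t \<in> carrier G" "b \<in> carrier G"
  shows "(t \<otimes> b \<otimes> inv t) [^] (m::int) = t \<otimes> b [^] m \<otimes> inv t"
proof -
  have "(\<lambda>x. t \<otimes> x \<otimes> inv t) \<in> hom G G"
    using assms(1) by (auto intro!: homI simp: m_assoc inv_solve_left)
  from hom_int_pow[OF this assms(2) is_group is_group] show ?thesis by simp
qed

text \<open>As \<open>t [^] (m - 1)\<close> lies in the abelian group \<open>A\<close>, the elements
  \<open>t [^] i\<close> and \<open>t [^] (m * i)\<close> act alike on \<open>A\<close> by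
  conjugation, so the map is multiplicative. Coprimality makes it injective.\<close>

lemma power_automorphism:
  fixes m :: int
  assumes fin: "finite (carrier G)" and A: "A \<lhd> G"
    and comm: "\<And>x y. x \<in> A \<Longrightarrow> y \<in> A \<Longrightarrow> x \<otimes> y = y \<otimes> x"
    and t: "t \<in> carrier G"
    and gen: "\<And>x. x \<in> carrier G \<Longrightarrow> \<exists>a\<in>A. \<exists>i::int. x = a \<otimes> t [^] i"
    and m1: "t [^] (m - 1) \<in> A" and cop: "coprime m (int (order G))"
  obtains \<phi> where "\<phi> \<in> auto G" "\<And>a. a \<in> A \<Longrightarrow> \<phi> a = a [^] m" "\<phi> t = t [^] m"
proof -
  interpret A: normal A G by (rule A)
  note sub = A.subset[THEN subsetD]
  have powA: "a [^] i \<in> A" if "a \<in> A" for a and i :: int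
    by (rule subgroup_int_pow_closed[OF A.subgroup_axioms that])
  have tm: "t [^] (m * i) = t [^] i \<otimes> t [^] ((m - 1) * i)"
    and tmA: "t [^] ((m - 1) * i) \<in> A" for i
    using t powA[OF m1] by (simp_all add: int_pow_mult int_pow_pow algebra_simps flip: int_pow_mult)
  have powi: "(a \<otimes> b) [^] m = a [^] m \<otimes> b [^] m" if "a \<in> A" "b \<in> A" for a b
    using that comm sub by (simp add: int_pow_mult_distrib)
  \<comment> \<open>Two representations of an element differ by a power of \<open>t\<close> inside
    \<open>A\<close>, where raising to the power \<open>m\<close> is multiplicative.\<close>
  have wd: "a [^] m \<otimes> t [^] (m * i) = b [^] m \<otimes> t [^] (m * j)"
    if a: "a \<in> A" and b: "b \<in> A" and eq: "a \<otimes> t [^] i = b \<otimes> t [^] j" for a b i j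
  proof -
    have "a \<otimes> t [^] (i - j) = a \<otimes> t [^] i \<otimes> inv (t [^] j)"
      using a t sub by (simp add: int_pow_diff m_assoc)
    also have "\<dots> = b" using b t sub by (simp add: eq m_assoc)
    finally have d: "b = a \<otimes> t [^] (i - j)" ..
    then have "t [^] (i - j) = inv a \<otimes> b" using a t sub by (simp flip: m_assoc)
    then have dA: "t [^] (i - j) \<in> A" using a b by simp
    from d have "b [^] m = a [^] m \<otimes> t [^] ((i - j) * m)"
      using powi[OF a dA] t by (simp add: int_pow_pow)
    then show ?thesis
      using a t sub by (simp add: m_assoc algebra_simps flip: int_pow_mult)
  qed
  have "\<exists>y. \<forall>a\<in>A. \<forall>i. x = a \<otimes> t [^] i \<longrightarrow> y = a [^] m \<otimes> t [^] (m * i)" if "x \<in> carrier G" for x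
    using gen[OF that] wd by metis
  then obtain f where f0:
    "\<And>x a i. x \<in> carrier G \<Longrightarrow> a \<in> A \<Longrightarrow> x = a \<otimes> t [^] i \<Longrightarrow> f x = a [^] m \<otimes> t [^] (m * i)"
    by metis
  have f: "f (a \<otimes> t [^] i) = a [^] m \<otimes> t [^] (m * i)" if "a \<in> A" for a i
    using f0[OF _ that refl] that t sub by blast
  have fhom: "f \<in> hom G G"
  proof (rule homI)
    fix x assume "x \<in> carrier G"
    then show "f x \<in> carrier G" using gen[of x] f t sub by fastforce
  next
    fix x y assume "x \<in> carrier G" "y \<in> carrier G"
    then obtain a i b j where x: "a \<in> A" "x = a \<otimes> t [^] (i::int)" and y: "b \<in> A" "y = b \<otimes> t [^] (j::int)"
      using gen by meson
    \<comment> \<open>\<open>c\<close> arises from moving \<open>t [^] i\<close> past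
      \<open>b\<close>, and \<open>d\<close> is the quotient of \<open>t [^] (m * i)\<close> by
      \<open>t [^] i\<close>. Since \<open>d\<close> commutes with \<open>b [^] m\<close>,
      conjugation by \<open>t [^] (m * i)\<close> sends \<open>b [^] m\<close> to
      \<open>c [^] m\<close>.\<close>
    define c where "c = t [^] i \<otimes> b \<otimes> inv (t [^] i)"
    define d where "d = t [^] ((m - 1) * i)"
    have cA: "c \<in> A" unfolding c_def using y t by (intro A.inv_op_closed2) auto
    have dA: "d \<in> A" unfolding d_def by (rule tmA)
    note carr = sub[OF x(1)] sub[OF y(1)] sub[OF cA] sub[OF dA] t
    have bm: "b [^] m \<in> A" by (rule powA[OF y(1)])
    have "c [^] m \<otimes> t [^] (m * i) = t [^] i \<otimes> b [^] m \<otimes> inv (t [^] i) \<otimes> (t [^] i \<otimes> d)"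
      using carr by (simp add: c_def int_pow_conjugate tm d_def)
    also have "\<dots> = t [^] i \<otimes> (b [^] m \<otimes> d)"
      using carr by (simp add: m_assoc) (simp flip: m_assoc)
    also have "\<dots> = t [^] (m * i) \<otimes> b [^] m"
      using carr comm[OF bm dA] by (simp add: tm d_def m_assoc)
    finally have c: "c [^] m \<otimes> t [^] (m * i) = t [^] (m * i) \<otimes> b [^] m" .
    have ct: "c \<otimes> t [^] i = t [^] i \<otimes> b"
      using carr by (simp add: c_def m_assoc)
    have "x \<otimes> y = a \<otimes> (t [^] i \<otimes> b) \<otimes> t [^] j"
      using x y carr by (simp add: m_assoc)
    also have "\<dots> = (a \<otimes> c) \<otimes> t [^] (i + j)"
      using carr by (simp add: m_assoc int_pow_mult flip: ct)
    finally have "f (x \<otimes> y) = (a \<otimes> c) [^] m \<otimes> t [^] (m * (i + j))"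
      using x cA by (simp add: f)
    also have "\<dots> = a [^] m \<otimes> (c [^] m \<otimes> t [^] (m * i)) \<otimes> t [^] (m * j)"
      using carr powi[OF x(1) cA] by (simp add: m_assoc int_pow_mult distrib_left)
    also have "\<dots> = f x \<otimes> f y"
      unfolding c using x y carr by (simp add: f m_assoc)
    finally show "f (x \<otimes> y) = f x \<otimes> f y" .
  qed
  interpret f: group_hom G G f
    by unfold_locales (rule fhom)
  \<comment> \<open>An element of the kernel has its \<open>t\<close>-part in \<open>A\<close>, so
    \<open>f\<close> maps it to its power \<open>m\<close>; its order then divides both
    \<open>m\<close> and the group order.\<close>
  have "x = \<one>" if x: "x \<in> carrier G" "f x = \<one>" for x
  proof -
    obtain a i where ai: "a \<in> A" "x = a \<otimes> t [^] (i::int)" using gen x by meson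
    have e: "a [^] m \<otimes> t [^] (m * i) = \<one>" using x(2) ai f by simp
    have amA: "a [^] m \<in> A" by (rule powA[OF ai(1)])
    have "t [^] (m * i) = inv (a [^] m)"
      using e amA t sub by (metis int_pow_closed inv_equality inv_comm)
    then have "t [^] (m * i) \<in> A" using amA by simp
    moreover have "t [^] i = t [^] (m * i) \<otimes> inv (t [^] ((m - 1) * i))"
      using t by (simp add: algebra_simps flip: int_pow_diff)
    ultimately have tiA: "t [^] i \<in> A" using tmA[of i] by simp
    have "x [^] m = \<one>"
      using powi[OF ai(1) tiA] e t ai(2) by (simp add: int_pow_pow mult.commute)
    then have "int (ord x) dvd m" using int_pow_eq_id x(1) by blast
    moreover have "int (ord x) dvd int (order G)" using ord_dvd_group_order x(1) by simp
    ultimately have "is_unit (int (ord x))" using cop coprime_common_divisor by blast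
    then show ?thesis using ord_eq_1 x(1) by simp
  qed
  then have inj: "inj_on f (carrier G)"
    using f.inj_on_one_iff by blast
  then have "bij_betw f (carrier G) (carrier G)"
    using endo_inj_surj[OF fin] f.hom_closed by (simp add: bij_betw_def image_subsetI)
  \<comment> \<open>Members of \<open>auto G\<close> must be \<open>undefined\<close> outside the
    carrier, hence the restriction.\<close>
  then have bij: "bij_betw (restrict f (carrier G)) (carrier G) (carrier G)"
    by (simp cong: bij_betw_cong)
  have "restrict f (carrier G) \<in> auto G"
    using bij fhom by (auto simp: auto_def Bij_def hom_def)
  moreover have "restrict f (carrier G) a = a [^] m" if "a \<in> A" for a
    using f[OF that, of 0] sub[OF that] by simp
  moreover have "restrict f (carrier G) t = t [^] m"
    using f[OF A.one_closed, of 1] t by simp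
  ultimately show ?thesis by (rule that)
qed

section \<open>Generators modulo the normal subgroup\<close>

text \<open>The quotient is trivial or of prime order, so any nontrivial coset generates it, in
  particular that of \<open>g\<close> when \<open>g\<close> is outside \<open>A\<close>.\<close>

lemma generator_mod_normal:
  assumes fin: "finite (carrier G)" and A: "A \<lhd> G" and idx: "card (rcosets A) \<le> 3"
    and g: "g \<in> carrier G"
  obtains t where "t \<in> carrier G" "g \<in> A \<or> t = g"
    "\<And>x. x \<in> carrier G \<Longrightarrow> \<exists>a\<in>A. \<exists>i::int. x = a \<otimes> t [^] i"
    "t [^] card (rcosets A) \<in> A"
proof -
  interpret A: normal A G by (rule A)
  interpret Q: group "G Mod A" by (rule A.factorgroup_is_group)
  have carQ: "carrier (G Mod A) = rcosets A" and oneQ: "\<one>\<^bsub>G Mod A\<^esub> = A"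
    by (simp_all add: FactGroup_def)
  have ordQ: "order (G Mod A) = card (rcosets A)" by (simp add: order_def carQ)
  have finQ: "finite (carrier (G Mod A))"
    unfolding carQ using fin A.subset by (metis finite_UnionD rcosets_part_G A.subgroup_axioms)
  have coset: "A #> x \<in> carrier (G Mod A)" if "x \<in> carrier G" for x
    unfolding carQ using that A.subset by (rule rcosetsI[rotated])
  have coset_one: "A #> x = A \<longleftrightarrow> x \<in> A" if "x \<in> carrier G" for x
    using that by (metis A.subgroup_axioms coset_join1 coset_join2)
  have hom: "(\<lambda>x. A #> x) \<in> hom G (G Mod A)" by (rule A.r_coset_hom_Mod)
  have powQ: "(A #> x) [^]\<^bsub>G Mod A\<^esub> i = A #> (x [^] i)" if "x \<in> carrier G" for x and i :: int
    using hom_int_pow[OF hom that is_group Q.is_group] by simp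
  have npos: "order (G Mod A) > 0" using finQ Q.order_gt_0_iff_finite by blast
  obtain t where t: "t \<in> carrier G" "g \<in> A \<or> t = g"
    and full: "Q.ord (A #> t) = order (G Mod A)"
  proof -
    have *: "Q.ord q = order (G Mod A)" if "q \<in> carrier (G Mod A)" "q \<noteq> A" for q
    proof -
      have "Q.ord q dvd order (G Mod A)" using Q.ord_dvd_group_order that by blast
      moreover have "Q.ord q \<noteq> 1" using Q.ord_eq_1[OF that(1)] that(2) by (simp add: oneQ)
      moreover have "order (G Mod A) \<in> {1, 2, 3}" using npos idx ordQ by auto
      moreover have "Factorial_Ring.prime (2::nat)" "Factorial_Ring.prime (3::nat)" by simp_all
      ultimately show ?thesis by (auto simp: prime_nat_iff)
    qed
    show ?thesis
    proof (cases "g \<in> A")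
      case False
      then show ?thesis using that[OF g] *[OF coset[OF g]] coset_one[OF g] by blast
    next
      case gA: True
      show ?thesis
      proof (cases "\<exists>q\<in>carrier (G Mod A). q \<noteq> A")
        case True
        then obtain x where "x \<in> carrier G" "A #> x \<noteq> A"
          by (auto simp: carQ RCOSETS_def)
        then show ?thesis using that gA * coset by blast
      next
        \<comment> \<open>Here the quotient is trivial and \<open>\<one>\<close> serves as
          \<open>t\<close>.\<close>
        case False
        then have "carrier (G Mod A) = {A}" using Q.one_closed oneQ by auto
        then have "order (G Mod A) = 1" by (simp add: order_def)
        moreover have "Q.ord (A #> \<one>) = 1"
          using Q.ord_eq_1[OF coset[OF one_closed]] coset_one[OF one_closed] by (simp add: oneQ)
        ultimately show ?thesis using that[of \<one>] gA by simp
      qed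
    qed
  qed
  have "generate (G Mod A) {A #> t} \<subseteq> carrier (G Mod A)"
    using Q.generate_incl coset[OF t(1)] by simp
  \<comment> \<open>The cyclic subgroup has as many elements as the whole finite quotient.\<close>
  then have genQ: "generate (G Mod A) {A #> t} = carrier (G Mod A)"
    using full Q.generate_pow_card[OF coset[OF t(1)]] finQ
    by (simp add: card_subset_eq order_def)
  show ?thesis
  proof (rule that[OF t])
    fix x assume x: "x \<in> carrier G"
    have "A #> x \<in> generate (G Mod A) {A #> t}" using coset[OF x] genQ by simp
    then obtain i :: int where "A #> x = A #> (t [^] i)"
      unfolding Q.generate_pow[OF coset[OF t(1)]] powQ[OF t(1)] by blast
    then have "x \<in> A #> (t [^] i)"
      using rcos_self[OF x A.subgroup_axioms] by simp
    then show "\<exists>a\<in>A. \<exists>i::int. x = a \<otimes> t [^] i" by (auto simp: r_coset_def)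
  next
    have "(A #> t) [^]\<^bsub>G Mod A\<^esub> int (card (rcosets A)) = A"
      using Q.pow_order_eq_1[OF coset[OF t(1)]] by (simp add: ordQ oneQ int_pow_int)
    then show "t [^] card (rcosets A) \<in> A"
      using powQ[OF t(1), of "int (card (rcosets A))"] t(1)
      by (simp add: int_pow_int flip: coset_one)
  qed
qed

section \<open>From rational to real conjugacy\<close>

text \<open>The core case of rational conjugacy, with equal cyclic subgroups; the general case
  differs from it by an automorphism.\<close>

lemma generator_aut_conj:
  assumes fin: "finite (carrier G)" and A: "A \<lhd> G" and idx: "card (rcosets A) \<le> 3"
    and comm: "\<And>x y. x \<in> A \<Longrightarrow> y \<in> A \<Longrightarrow> x \<otimes> y = y \<otimes> x"
    and g: "g \<in> carrier G" and u: "u \<in> carrier G" and gu: "generate G {g} = generate G {u}"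
  shows "(u, g) \<in> real_aut_conj G"
proof -
  interpret A: normal A G by (rule A)
  have "u \<in> generate G {g}" "g \<in> generate G {u}" using gu by (auto intro: generate.incl)
  then obtain k l :: int where k: "u = g [^] k" and l: "g = u [^] l"
    unfolding generate_pow[OF g] generate_pow[OF u] by blast
  \<comment> \<open>\<open>k\<close> and \<open>l\<close> are inverse to each other modulo the order
    of \<open>g\<close>, so \<open>k\<close> is a unit there.\<close>
  have "g [^] (k * l) = g [^] (1::int)" using k l g by (simp flip: int_pow_pow)
  then have kl: "int (ord g) dvd k * l - 1"
    using int_pow_eq[OF g] by (metis dvd_diff_commute)
  have "coprime k (int (ord g))"
  proof (rule coprimeI)
    fix c assume "c dvd k" "c dvd int (ord g)"
    then have "c dvd k * l" "c dvd k * l - 1" using kl dvd_trans by auto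
    then show "is_unit c" by (simp add: dvd_diff_right_iff)
  qed
  moreover have ord0: "order G > 0" using fin order_gt_0_iff_finite by blast
  ultimately obtain m0 where m0: "int (ord g) dvd m0 - k" "coprime m0 (int (order G))"
    using coprime_lift[of k "int (ord g)" "int (order G)"] by auto
  define n where "n = card (rcosets A)"
  have lag: "n * card A = order G" unfolding n_def by (rule lagrange[OF A.subgroup_axioms])
  \<comment> \<open>The index divides the group order, so \<open>m0\<close> is also a unit modulo
    the index.\<close>
  then have "coprime m0 (int n)" "n > 0"
    using m0(2) ord0 by (auto simp flip: lag)
  then obtain m where m: "m = m0 \<or> m = - m0" "int n dvd m - 1"
    using unit_mod_le_3[of m0 "int n"] idx by (auto simp: n_def)
  have cop: "coprime m (int (order G))" using m(1) m0(2) by auto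
  obtain t where t: "t \<in> carrier G" "g \<in> A \<or> t = g"
    and gen: "\<And>x. x \<in> carrier G \<Longrightarrow> \<exists>a\<in>A. \<exists>i::int. x = a \<otimes> t [^] i"
    and tn: "t [^] n \<in> A"
    unfolding n_def using generator_mod_normal[OF fin A idx g] by blast
  obtain q where "m - 1 = int n * q" using m(2) by (elim dvdE)
  then have "t [^] (m - 1) = (t [^] n) [^] q" using t by (simp add: int_pow_int flip: int_pow_pow)
  then have "t [^] (m - 1) \<in> A" using subgroup_int_pow_closed[OF A.subgroup_axioms tn] by simp
  then obtain \<phi> where \<phi>: "\<phi> \<in> auto G" "\<And>a. a \<in> A \<Longrightarrow> \<phi> a = a [^] m" "\<phi> t = t [^] m"
    using power_automorphism[OF fin A comm t(1) gen _ cop] by blast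
  \<comment> \<open>Either \<open>g\<close> lies in \<open>A\<close> or \<open>g = t\<close>;
    \<open>\<phi>\<close> raises both kinds of elements to the power \<open>m\<close>.\<close>
  have \<phi>g: "\<phi> g = g [^] m" using t(2) \<phi> by auto
  have gm0: "g [^] m0 = u"
    using m0(1) int_pow_eq[OF g] k by (metis dvd_diff_commute)
  have "u = \<phi> g \<or> u = \<phi> (inv g)"
    using m(1)
  proof
    assume "m = m0"
    then show ?thesis using \<phi>g gm0 by simp
  next
    assume "m = - m0"
    then show ?thesis using \<phi>g gm0 auto_inv[OF \<phi>(1) g] g u by (simp add: int_pow_neg)
  qed
  then show ?thesis using \<phi>(1) g u by (auto simp: real_aut_conj_def mem_orbit_AutoGroup)
qed

lemma auto_image_generate:
  assumes "\<phi> \<in> auto G" "x \<in> carrier G"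
  shows "\<phi> ` generate G {x} = generate G {\<phi> x}"
proof -
  interpret group_hom G G \<phi>
    using assms(1) by unfold_locales (simp add: auto_def)
  show ?thesis using generate_img[of "{x}"] assms(2) by simp
qed

lemma generate_inv_singleton:
  assumes "x \<in> carrier G"
  shows "generate G {inv x} = generate G {x}"
proof -
  have "generate G {inv y} \<subseteq> generate G {y}" if "y \<in> carrier G" for y
    using that by (intro generate_subgroup_incl generate_is_subgroup) (auto intro: generate.inv)
  from this[OF assms] this[of "inv x"] assms show ?thesis by auto
qed

text \<open>Automorphisms commute with generation, and an element and its inverse generate the same
  subgroup.\<close>

lemma real_aut_conj_subset_rat: "real_aut_conj G \<subseteq> rat_aut_conj G"
proof (rule subrelI)
  fix g h assume "(g, h) \<in> real_aut_conj G"
  then obtain \<phi> where \<phi>: "g \<in> carrier G" "h \<in> carrier G" "\<phi> \<in> auto G"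
    and or: "g = \<phi> h \<or> g = \<phi> (inv h)"
    by (auto simp: real_aut_conj_def mem_orbit_AutoGroup)
  have "generate G {g} = \<phi> ` generate G {h}"
    using or
  proof
    assume "g = \<phi> h"
    then show ?thesis using \<phi> by (simp add: auto_image_generate)
  next
    assume "g = \<phi> (inv h)"
    then have "generate G {g} = \<phi> ` generate G {inv h}" using \<phi> by (simp add: auto_image_generate)
    then show ?thesis using \<phi> by (simp add: generate_inv_singleton)
  qed
  then show "(g, h) \<in> rat_aut_conj G"
    using \<phi> unfolding rat_aut_conj_def mem_orbit_AutoGroup by blast
qed

end

theorem mainTheorem2:
  fixes G (structure) and A :: "'a set"
  assumes "group G" and "finite (carrier G)"
    and "A \<lhd> G" and "comm_group (G\<lparr>carrier := A\<rparr>)" and "card (rcosets A) \<le> 3"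
  shows "aut_class_diff G = 0"
proof -
  interpret group G by fact
  have comm: "x \<otimes> y = y \<otimes> x" if "x \<in> A" "y \<in> A" for x y
    using comm_groupE(4)[OF assms(4)] that by simp
  have "(g, h) \<in> real_aut_conj G" if gh: "(g, h) \<in> rat_aut_conj G" for g h
  proof -
    obtain \<phi> where \<phi>: "g \<in> carrier G" "h \<in> carrier G" "\<phi> \<in> auto G"
      "generate G {g} = \<phi> ` generate G {h}"
      using gh by (auto simp: rat_aut_conj_def mem_orbit_AutoGroup)
    \<comment> \<open>\<open>g\<close> and \<open>\<phi> h\<close> generate the same subgroup, so
      the core case applies; \<open>\<phi>\<close> itself links \<open>\<phi> h\<close> to
      \<open>h\<close>.\<close>
    have "(g, \<phi> h) \<in> real_aut_conj G"
      using \<phi> auto_image_generate auto_closed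
      by (intro generator_aut_conj[OF assms(2,3,5) comm]) auto
    moreover have "(\<phi> h, h) \<in> real_aut_conj G"
      using \<phi> auto_closed by (auto simp: real_aut_conj_def mem_orbit_AutoGroup)
    ultimately show ?thesis
      using equiv_real_aut_conj by (meson equivE transD)
  qed
  then have "real_aut_conj G = rat_aut_conj G"
    using real_aut_conj_subset_rat by auto
  then show ?thesis by (simp add: aut_class_diff_def)
qed

end
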